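(* For every $m\ge1$ and every $1\le p<\infty$, $$\mathfrak{G}_p:=\inf\{F_p(\Omega):\Omega \text{ open in }\mathbb{R}^m,\ 0<|\Omega|<\infty\}=0.$$
   Context: For a non-empty open $\Omega\subset\mathbb{R}^m$ with $|\Omega|<\infty$, $\lambda_1(\Omega)=\inf_{\varphi\in H_0^1(\Omega)\setminus\{0\}}\int_\Omega|D\varphi|^2/\int_\Omega\varphi^2$, $v_\Omega$ is the unique solution of $-\Delta v=1$, $v\in H_0^1(\Omega)$, and $F_p(\Omega)=\|v_\Omega\|_{L^p(\Omega)}\lambda_1(\Omega)/|\Omega|^{1/p}$. *)

theory Defs
  imports "HOL-Analysis.Analysis"
begin

text \<open>Infinitely differentiable real functions on a Euclidean space (greatest fixed point:
  f is differentiable everywhere and every directional derivative is again C-infinity).\<close>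
definition smooth_fun :: "('a::euclidean_space \<Rightarrow> real) \<Rightarrow> bool" where
  "smooth_fun f \<longleftrightarrow> (\<exists>S. f \<in> S \<and>
     (\<forall>g\<in>S. \<exists>g'. (\<forall>x. (g has_derivative g' x) (at x)) \<and> (\<forall>v. (\<lambda>x. g' x v) \<in> S)))"

definition test_fun :: "'a::euclidean_space set \<Rightarrow> ('a \<Rightarrow> real) \<Rightarrow> ('a \<Rightarrow> 'a) \<Rightarrow> bool" where
  "test_fun \<Omega> \<phi> G \<longleftrightarrow> smooth_fun \<phi> \<and>
     (\<forall>x. (\<phi> has_derivative (\<lambda>h. G x \<bullet> h)) (at x)) \<and>
     compact (closure {x. \<phi> x \<noteq> 0}) \<and> closure {x. \<phi> x \<noteq> 0} \<subseteq> \<Omega>"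

definition H01 :: "'a::euclidean_space set \<Rightarrow> ('a \<Rightarrow> real) \<Rightarrow> ('a \<Rightarrow> 'a) \<Rightarrow> bool" where
  "H01 \<Omega> u g \<longleftrightarrow>
     u \<in> borel_measurable lebesgue \<and> g \<in> borel_measurable lebesgue \<and>
     integrable lebesgue (\<lambda>x. (u x)\<^sup>2) \<and> integrable lebesgue (\<lambda>x. (norm (g x))\<^sup>2) \<and>
     (\<exists>\<phi> G. (\<forall>n. test_fun \<Omega> (\<phi> n) (G n)) \<and>
        (\<lambda>n. \<integral>x. (\<phi> n x - u x)\<^sup>2 \<partial>lebesgue) \<longlonglongrightarrow> 0 \<and>
        (\<lambda>n. \<integral>x. (norm (G n x - g x))\<^sup>2 \<partial>lebesgue) \<longlonglongrightarrow> 0)"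

definition lambda1 :: "'a::euclidean_space set \<Rightarrow> real" where
  "lambda1 \<Omega> = Inf {(\<integral>x\<in>\<Omega>. (norm (g x))\<^sup>2 \<partial>lebesgue) / (\<integral>x\<in>\<Omega>. (u x)\<^sup>2 \<partial>lebesgue) | u g.
        H01 \<Omega> u g \<and> (\<integral>x\<in>\<Omega>. (u x)\<^sup>2 \<partial>lebesgue) \<noteq> 0}"

text \<open>v (with weak gradient g) is the (weak) solution of -Delta v = 1, v in H_0^1(Omega).\<close>
definition torsion :: "'a::euclidean_space set \<Rightarrow> ('a \<Rightarrow> real) \<Rightarrow> ('a \<Rightarrow> 'a) \<Rightarrow> bool" where
  "torsion \<Omega> v g \<longleftrightarrow> H01 \<Omega> v g \<and>
     (\<forall>\<psi> G. test_fun \<Omega> \<psi> G \<longrightarrow>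
        (\<integral>x\<in>\<Omega>. g x \<bullet> G x \<partial>lebesgue) = (\<integral>x\<in>\<Omega>. \<psi> x \<partial>lebesgue))"

definition Fp_of :: "real \<Rightarrow> 'a::euclidean_space set \<Rightarrow> ('a \<Rightarrow> real) \<Rightarrow> real" where
  "Fp_of p \<Omega> v = ((\<integral>x\<in>\<Omega>. \<bar>v x\<bar> powr p \<partial>lebesgue) powr (1 / p)) * lambda1 \<Omega>
       / (measure lebesgue \<Omega>) powr (1 / p)"

end

theory Submission
  imports Defs
begin

text \<open>
  Take the disjoint union of the unit ball with \<open>j ^ (m + 1)\<close> balls of radius \<open>1 / j\<close>. The first
  eigenvalue stays below a Rayleigh quotient of the unit ball, which does not depend on \<open>j\<close>. The
  torsion function is \<open>(r\<^sup>2 - |x - c|\<^sup>2) / (2 m)\<close> on each ball, so the small balls, of total volume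
  \<open>j\<close> times that of the unit ball, contribute to \<open>\<integral> v\<^sup>p\<close> at most the volume of the unit ball, while
  the volume of the union grows like \<open>j\<close>. Hence \<open>F\<^sub>p = O (j powr (- 1 / p))\<close>.

  The torsion function is approximated in \<open>H\<^sub>0\<^sup>1\<close> by test functions \<open>\<eta> (w - d)\<close>, where \<open>w\<close> is the
  paraboloid and \<open>\<eta> t = t exp (- d / t)\<close> for \<open>t > 0\<close>; note that \<open>0 \<le> \<eta>' \<le> 1\<close>.
\<close>

section \<open>Flat functions and a class of smooth functions built from them\<close>

text \<open>The factor \<open>1 / t ^ k\<close> is carried along because the derivatives of
  \<open>exp (- d / t)\<close> are combinations of such terms: for fixed \<open>d\<close>,
  differentiation raises \<open>k\<close> by 1 or 2 and stays in the family.\<close>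

definition flat_exp :: "real \<Rightarrow> nat \<Rightarrow> real \<Rightarrow> real" where
  "flat_exp d k t = (if t \<le> 0 then 0 else exp (- d / t) / t ^ k)"

text \<open>From \<open>(1 + y / n) ^ n \<le> exp y\<close> with \<open>y = d / t\<close> and
  \<open>n = k + 2\<close>. The exponent \<open>k + 2\<close> absorbs \<open>t ^ k\<close> and
  leaves a spare square, which is what flatness at 0 requires.\<close>

lemma flat_exp_le_square:
  assumes "0 < d"
  shows "\<bar>flat_exp d k t\<bar> \<le> (real (k + 2) / d) ^ (k + 2) * t\<^sup>2"
proof (cases "t \<le> 0")
  case False
  have "(d / (t * real (k + 2))) ^ (k + 2) \<le> (1 + d / t / real (k + 2)) ^ (k + 2)"
    using False assms by (intro power_mono) auto
  also have "\<dots> \<le> exp (d / t)"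
    using False assms by (intro exp_ge_one_plus_x_over_n_power_n) (auto intro: order_trans[of _ 0])
  finally have "exp (- d / t) \<le> 1 / (d / (t * real (k + 2))) ^ (k + 2)"
    using False assms
    by (simp only: minus_divide_left[symmetric] exp_minus inverse_eq_divide)
       (intro divide_left_mono mult_pos_pos zero_less_power divide_pos_pos exp_gt_zero; simp)
  also have "\<dots> = (real (k + 2) / d) ^ (k + 2) * t\<^sup>2 * t ^ k"
    by (simp add: power_divide power_mult_distrib power_add power2_eq_square mult_ac del: of_nat_add)
  finally show ?thesis using False by (simp add: flat_exp_def divide_le_eq del: of_nat_add)
qed (use assms in \<open>simp add: flat_exp_def\<close>)

lemma has_derivative_flat_exp:
  assumes "0 < d"
  shows "(flat_exp d k has_real_derivative
           d * flat_exp d (k + 2) t - real k * flat_exp d (k + 1) t) (at t)"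
proof -
  consider "t < 0" | "t > 0" | "t = 0" by linarith
  then show ?thesis
  proof cases
    case 1
    have "((\<lambda>_. 0) has_real_derivative 0) (at t)" by simp
    then have "(flat_exp d k has_real_derivative 0) (at t)"
      by (rule has_field_derivative_transform_within_open[where S="{..<0}"])
         (use 1 in \<open>auto simp: flat_exp_def\<close>)
    then show ?thesis using 1 by (simp add: flat_exp_def)
  next
    case 2
    have "((\<lambda>t. exp (- d / t) / t ^ k) has_real_derivative
        d * (exp (- d / t) / t ^ (k + 2)) - real k * (exp (- d / t) / t ^ (k + 1))) (at t)"
    proof (rule DERIV_cong)
      \<comment> \<open>Writing \<open>t ^ k / t\<close> avoids the truncated exponent
        \<open>k - 1\<close>, so \<open>k = 0\<close> fits the same formula.\<close>
      have "((\<lambda>t. t ^ k) has_real_derivative real k * t ^ k / t) (at t)"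
        by (rule DERIV_cong[OF DERIV_pow]) (use 2 in \<open>cases k; simp\<close>)
      moreover have "((\<lambda>t. exp (- d / t)) has_real_derivative exp (- d / t) * (d / t\<^sup>2)) (at t)"
        using 2 by (auto intro!: derivative_eq_intros simp: power2_eq_square)
      ultimately show "((\<lambda>t. exp (- d / t) / t ^ k) has_real_derivative
        (exp (- d / t) * (d / t\<^sup>2) * t ^ k - exp (- d / t) * (real k * t ^ k / t)) / (t ^ k * t ^ k)) (at t)"
        using 2 by (intro DERIV_divide) auto
    qed (use 2 in \<open>simp add: field_simps power2_eq_square\<close>)
    then have "(flat_exp d k has_real_derivative
        d * (exp (- d / t) / t ^ (k + 2)) - real k * (exp (- d / t) / t ^ (k + 1))) (at t)"
      by (rule has_field_derivative_transform_within_open[where S="{0<..}"])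
         (use 2 in \<open>auto simp: flat_exp_def\<close>)
    then show ?thesis using 2 by (simp add: flat_exp_def)
  next
    case 3
    \<comment> \<open>At the junction \<open>t = 0\<close> the quadratic bound makes the difference
      quotient at most \<open>C * \<bar>h\<bar>\<close>, so the derivative is 0, which is also the
      value of the claimed formula there.\<close>
    define C where "C = (real (k + 2) / d) ^ (k + 2)"
    have C: "\<bar>flat_exp d k t\<bar> \<le> C * t\<^sup>2" for t
      using flat_exp_le_square[OF assms] by (simp add: C_def del: of_nat_add)
    have "((\<lambda>h. flat_exp d k h / h) \<longlongrightarrow> 0) (at 0)"
    proof (rule Lim_null_comparison)
      show "\<forall>\<^sub>F h in at 0. norm (flat_exp d k h / h) \<le> C * \<bar>h\<bar>"
        using C by (intro eventuallyI)
         (simp add: divide_simps power2_eq_square abs_mult mult.assoc)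
      show "((\<lambda>h. C * \<bar>h\<bar>) \<longlongrightarrow> 0) (at 0)"
        by (intro tendsto_eq_intros) auto
    qed
    then show ?thesis using 3 by (simp add: DERIV_def flat_exp_def)
  qed
qed

text \<open>Closed under directional derivatives, hence a witness for the set in \<open>smooth_fun\<close>.\<close>
inductive_set flat_algebra :: "real \<Rightarrow> ('a::euclidean_space \<Rightarrow> real) set" for d where
  const: "(\<lambda>_. a) \<in> flat_algebra d"
| inner: "(\<lambda>x. x \<bullet> v) \<in> flat_algebra d"
| square: "(\<lambda>x. x \<bullet> x) \<in> flat_algebra d"
| flat: "(\<lambda>x. flat_exp d k (a - b * ((x - c) \<bullet> (x - c)))) \<in> flat_algebra d"
| add: "f \<in> flat_algebra d \<Longrightarrow> g \<in> flat_algebra d \<Longrightarrow> (\<lambda>x. f x + g x) \<in> flat_algebra d"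
| mult: "f \<in> flat_algebra d \<Longrightarrow> g \<in> flat_algebra d \<Longrightarrow> (\<lambda>x. f x * g x) \<in> flat_algebra d"

lemma flat_algebra_diff:
  assumes "f \<in> flat_algebra d" "g \<in> flat_algebra d"
  shows "(\<lambda>x. f x - g x) \<in> flat_algebra d"
  using flat_algebra.add[OF assms(1) flat_algebra.mult[OF flat_algebra.const[of "-1"] assms(2)]]
  by simp

lemma flat_algebra_sum:
  assumes "\<And>i. i \<in> I \<Longrightarrow> f i \<in> flat_algebra d"
  shows "(\<lambda>x. \<Sum>i\<in>I. f i x) \<in> flat_algebra d"
  using assms
  by (induction I rule: infinite_finite_induct)
     (auto intro: flat_algebra.const flat_algebra.add)

text \<open>Only the generator \<open>flat\<close> needs work: the chain rule turns it into flat
  functions of orders \<open>k + 1\<close> and \<open>k + 2\<close> of the same quadratic argument,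
  times an affine function of \<open>x\<close>.\<close>

lemma flat_algebra_derivative:
  assumes "0 < d" "f \<in> flat_algebra d"
  shows "\<exists>f'. (\<forall>x. (f has_derivative f' x) (at x)) \<and> (\<forall>v. (\<lambda>x. f' x v) \<in> flat_algebra d)"
  using assms(2)
proof induction
  case (const a)
  show ?case
    by (rule exI[of _ "\<lambda>_ _. 0"]) (auto intro: flat_algebra.const)
next
  case (inner v)
  show ?case
    by (rule exI[of _ "\<lambda>_ h. h \<bullet> v"])
       (auto intro!: flat_algebra.const derivative_eq_intros)
next
  case square
  show ?case
  proof (intro exI conjI allI)
    show "((\<lambda>x. x \<bullet> x) has_derivative (\<lambda>h. 2 * (x \<bullet> h))) (at x)" for x :: 'a
      by (auto intro!: derivative_eq_intros simp: inner_commute)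
  qed (intro flat_algebra.mult flat_algebra.const flat_algebra.inner)
next
  case (flat k a b c)
  define w where "w = (\<lambda>x. a - b * ((x - c) \<bullet> (x - c)))"
  have w: "(w has_derivative (\<lambda>h. - 2 * b * (x \<bullet> h - c \<bullet> h))) (at x)" for x
    unfolding w_def
    by (auto intro!: derivative_eq_intros simp: inner_commute inner_diff_left inner_diff_right algebra_simps)
  show ?case
  proof (intro exI conjI allI)
    fix x
    show "((\<lambda>x. flat_exp d k (a - b * ((x - c) \<bullet> (x - c)))) has_derivative
      (\<lambda>h. (d * flat_exp d (k + 2) (w x) - real k * flat_exp d (k + 1) (w x)) *
            (- 2 * b * (x \<bullet> h - c \<bullet> h)))) (at x)"
      using has_derivative_compose[OF w has_derivative_flat_exp[OF assms(1), unfolded has_field_derivative_def]]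
      by (simp add: w_def)
  next
    fix h
    show "(\<lambda>x. (d * flat_exp d (k + 2) (w x) - real k * flat_exp d (k + 1) (w x)) *
            (- 2 * b * (x \<bullet> h - c \<bullet> h))) \<in> flat_algebra d"
      unfolding w_def
      by (intro flat_algebra.mult flat_algebra_diff flat_algebra.const flat_algebra.inner flat_algebra.flat)
  qed
next
  case (add f g)
  then obtain f' g' where *: "\<And>x. (f has_derivative f' x) (at x)" "\<And>x. (g has_derivative g' x) (at x)"
    "\<And>v. (\<lambda>x. f' x v) \<in> flat_algebra d" "\<And>v. (\<lambda>x. g' x v) \<in> flat_algebra d" by blast
  show ?case
    by (intro exI[of _ "\<lambda>x h. f' x h + g' x h"] conjI allI has_derivative_add flat_algebra.add *)
next
  case (mult f g)
  then obtain f' g' where *: "\<And>x. (f has_derivative f' x) (at x)" "\<And>x. (g has_derivative g' x) (at x)"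
    "\<And>v. (\<lambda>x. f' x v) \<in> flat_algebra d" "\<And>v. (\<lambda>x. g' x v) \<in> flat_algebra d" by blast
  show ?case
    by (intro exI[of _ "\<lambda>x h. f x * g' x h + f' x h * g x"] conjI allI has_derivative_mult
          flat_algebra.add flat_algebra.mult mult.hyps *)
qed

lemma smooth_fun_flat_algebra:
  assumes "0 < d" "f \<in> flat_algebra d"
  shows "smooth_fun f"
  unfolding smooth_fun_def using assms flat_algebra_derivative by blast

section \<open>Smooth approximation of the positive part\<close>

definition soft_pos :: "real \<Rightarrow> real \<Rightarrow> real" where
  "soft_pos d t = t * flat_exp d 0 t"

text \<open>The derivative of \<open>soft_pos d\<close>: for \<open>t > 0\<close> it equals
  \<open>(1 + d / t) * exp (- d / t)\<close>, a smooth substitute for the unit step.\<close>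

definition soft_step :: "real \<Rightarrow> real \<Rightarrow> real" where
  "soft_step d t = flat_exp d 0 t + d * flat_exp d 1 t"

lemma has_derivative_soft_pos:
  assumes "0 < d"
  shows "(soft_pos d has_real_derivative soft_step d t) (at t)"
proof -
  have "(soft_pos d has_real_derivative (1 * flat_exp d 0 t +
      (d * flat_exp d (0 + 2) t - real 0 * flat_exp d (0 + 1) t) * t)) (at t)"
    unfolding soft_pos_def [abs_def]
    by (rule DERIV_mult'[OF DERIV_ident has_derivative_flat_exp[OF assms], THEN DERIV_cong]) simp
  \<comment> \<open>The outer factor \<open>t\<close> cancels one power of the denominator, so order
    2 drops to order 1.\<close>
  moreover have "flat_exp d (0 + 2) t * t = flat_exp d 1 t"
    by (simp add: flat_exp_def power2_eq_square)
  ultimately show ?thesis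
    by (simp add: soft_step_def mult.assoc del: add_2_eq_Suc add_2_eq_Suc')
qed

lemma soft_pos_bounds:
  assumes "0 < d"
  shows "0 \<le> soft_pos d t" "soft_pos d t \<le> max 0 t"
  using assms by (auto simp: soft_pos_def flat_exp_def mult_le_cancel_left1)

text \<open>The upper bound is \<open>1 + y \<le> exp y\<close> at \<open>y = d / t\<close>. It
  later dominates the gradients of the approximants.\<close>

lemma soft_step_bounds:
  assumes "0 < d"
  shows "0 \<le> soft_step d t" "soft_step d t \<le> 1"
proof -
  show "0 \<le> soft_step d t" using assms by (simp add: soft_step_def flat_exp_def)
  have "1 + d / t \<le> exp (d / t)" by (rule exp_ge_add_one_self)
  moreover have "soft_step d t = (1 + d / t) * exp (- d / t)" if "0 < t"
    using that by (simp add: soft_step_def flat_exp_def field_simps)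
  ultimately show "soft_step d t \<le> 1"
    by (cases "0 < t") (simp_all add: soft_step_def flat_exp_def exp_minus pos_divide_le_eq flip: divide_inverse)
qed

lemma soft_eq_0:
  assumes "t \<le> 0"
  shows "soft_pos d t = 0" "soft_step d t = 0"
  using assms by (auto simp: soft_pos_def soft_step_def flat_exp_def)

text \<open>The same \<open>d n\<close> serves as shift and as smoothing parameter. For
  \<open>s > 0\<close> eventually \<open>d n < s\<close> and the explicit formulas have a limit; for
  \<open>s \<le> 0\<close>, including \<open>s = 0\<close>, the shifted argument is negative and
  every term is 0.\<close>

lemma tendsto_soft:
  defines "d \<equiv> \<lambda>n. inverse (real (Suc n))"
  shows "(\<lambda>n. soft_pos (d n) (s - d n)) \<longlonglongrightarrow> max 0 s"
    and "(\<lambda>n. soft_step (d n) (s - d n)) \<longlonglongrightarrow> (if 0 < s then 1 else 0)"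
proof -
  have d: "d \<longlonglongrightarrow> 0" unfolding d_def by (rule LIMSEQ_inverse_real_of_nat)
  have dpos: "0 < d n" for n by (simp add: d_def)
  have *: "(\<lambda>n. soft_pos (d n) (s - d n)) \<longlonglongrightarrow> max 0 s \<and>
     (\<lambda>n. soft_step (d n) (s - d n)) \<longlonglongrightarrow> (if 0 < s then 1 else 0)"
  proof (cases "0 < s")
    case True
    have ev: "\<forall>\<^sub>F n in sequentially. d n < s" using d True by (rule order_tendstoD)
    have e: "(\<lambda>n. exp (- d n / (s - d n))) \<longlonglongrightarrow> exp (- 0 / (s - 0))"
      using True by (intro tendsto_intros d) auto
    have "(\<lambda>n. (s - d n) * exp (- d n / (s - d n))) \<longlonglongrightarrow> (s - 0) * exp (- 0 / (s - 0))"
      by (intro tendsto_mult tendsto_diff tendsto_const d e)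
    moreover have "\<forall>\<^sub>F n in sequentially. (s - d n) * exp (- d n / (s - d n)) = soft_pos (d n) (s - d n)"
      using ev by eventually_elim (simp add: soft_pos_def flat_exp_def)
    moreover have "(\<lambda>n. exp (- d n / (s - d n)) + d n * (exp (- d n / (s - d n)) / (s - d n))) \<longlonglongrightarrow>
       exp (- 0 / (s - 0)) + 0 * (exp (- 0 / (s - 0)) / (s - 0))"
      using True by (intro tendsto_add tendsto_divide tendsto_mult tendsto_diff tendsto_const d e) auto
    moreover have "\<forall>\<^sub>F n in sequentially. exp (- d n / (s - d n)) + d n * (exp (- d n / (s - d n)) / (s - d n)) = soft_step (d n) (s - d n)"
      using ev by eventually_elim (simp add: soft_step_def flat_exp_def)
    ultimately show ?thesis using True
      by (auto intro: Lim_transform_eventually)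
  next
    case False
    then have "s - d n \<le> 0" for n using dpos[of n] by linarith
    then show ?thesis using False by (simp add: soft_eq_0)
  qed
  show "(\<lambda>n. soft_pos (d n) (s - d n)) \<longlonglongrightarrow> max 0 s"
    and "(\<lambda>n. soft_step (d n) (s - d n)) \<longlonglongrightarrow> (if 0 < s then 1 else 0)"
    using * by auto
qed

section \<open>Radial integration by parts on balls\<close>

lemma ball_borel [measurable]: "ball c r \<in> sets borel"
  by (intro borel_open open_ball)

lemma integral_lborel_dilation:
  fixes f :: "'a::euclidean_space \<Rightarrow> real"
  assumes [measurable]: "f \<in> borel_measurable borel" and "0 < t"
  shows "(\<integral>x. f (c + t *\<^sub>R (x - c)) \<partial>lborel) = (\<integral>x. f x \<partial>lborel) / t ^ DIM('a)"
proof -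
  have "(\<integral>x. f x \<partial>lborel) = t ^ DIM('a) * (\<integral>x. f ((c - t *\<^sub>R c) + t *\<^sub>R x) \<partial>lborel)"
    using assms(2)
    by (subst lborel_affine[of t "c - t *\<^sub>R c"])
       (simp_all add: integral_density integral_distr)
  also have "(\<lambda>x. f ((c - t *\<^sub>R c) + t *\<^sub>R x)) = (\<lambda>x. f (c + t *\<^sub>R (x - c)))"
    by (simp add: algebra_simps)
  finally show ?thesis using assms(2) by simp
qed

lemma integrable_lborel_bounded_support:
  fixes f :: "'a::euclidean_space \<Rightarrow> real"
  assumes "f \<in> borel_measurable borel" "\<And>x. \<bar>f x\<bar> \<le> M" "\<And>x. x \<notin> cball c R \<Longrightarrow> f x = 0"
  shows "integrable lborel f"
proof (rule Bochner_Integration.integrable_bound)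
  show "integrable lborel (\<lambda>x. M * indicator (cball c R) x :: real)"
    by (intro integrable_mult_right integrable_real_indicator) (simp_all add: emeasure_lborel_cball_finite[simplified])
  show "AE x in lborel. norm (f x) \<le> norm (M * indicator (cball c R) x :: real)"
    using assms(2,3) by (intro AE_I2) (fastforce simp: indicator_def intro: order_trans[OF _ abs_ge_self])
qed (use assms(1) in simp)

text \<open>Differentiating the change of variables for dilations about c at ratio 1 replaces the
  divergence theorem for the field \<open>x - c\<close>.\<close>
lemma integral_radial_derivative:
  fixes f :: "'a::euclidean_space \<Rightarrow> real"
  assumes deriv: "\<And>x. (f has_derivative (\<lambda>h. G x \<bullet> h)) (at x)"
    and bound: "\<And>x. norm (G x) \<le> M"
    and meas [measurable]: "G \<in> borel_measurable borel"
    and supp: "\<And>x. x \<notin> cball c R \<Longrightarrow> f x = 0"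
  shows "(\<integral>x. G x \<bullet> (x - c) \<partial>lborel) = - real DIM('a) * (\<integral>x. f x \<partial>lborel)"
proof -
  define d where "d = (\<lambda>n. inverse (real (Suc n)))"
  have dpos: "0 < d n" for n by (simp add: d_def)
  have "d \<longlonglongrightarrow> 0" unfolding d_def by (rule LIMSEQ_inverse_real_of_nat)
  then have d: "filterlim d (at 0) sequentially"
    using dpos by (intro filterlim_atI) (auto simp: less_imp_neq[THEN not_sym])
  have contf: "continuous_on UNIV f"
    by (intro continuous_at_imp_continuous_on ballI has_derivative_continuous[OF deriv])
  then have [measurable]: "f \<in> borel_measurable borel"
    by (rule borel_measurable_continuous_onI)
  \<comment> \<open>The gradient bound is a Lipschitz constant for \<open>f\<close>; it dominates
    the difference quotients below by \<open>M * R\<close> on the ball.\<close>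
  have lip: "\<bar>f y - f x\<bar> \<le> M * norm (y - x)" for x y
  proof -
    have "onorm (\<lambda>h. G x \<bullet> h) \<le> M" for x
      by (rule onorm_le) (metis Cauchy_Schwarz_ineq2 bound mult_right_mono norm_ge_zero order_trans real_norm_def)
    then show ?thesis
      using differentiable_bound[of UNIV f "\<lambda>x h. G x \<bullet> h" M y x] deriv by simp
  qed
  have M: "0 \<le> M" using bound[of 0] norm_ge_zero order_trans by blast
  \<comment> \<open>Difference quotients of \<open>f\<close> in the dilation ratio at 1. Their
    integrals are evaluated in two ways.\<close>
  define s where "s = (\<lambda>n x. (f (c + (1 + d n) *\<^sub>R (x - c)) - f x) / d n)"
  have "bounded (f ` cball c R)"
    by (intro compact_imp_bounded compact_continuous_image continuous_on_subset[OF contf]) auto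
  then obtain K where K: "\<And>x. x \<in> cball c R \<Longrightarrow> \<bar>f x\<bar> \<le> K"
    unfolding bounded_iff by (auto simp del: mem_cball)
  have "\<bar>f x\<bar> \<le> \<bar>K\<bar>" for x
    using K[of x] supp[of x] by (cases "x \<in> cball c R") auto
  then have intf: "integrable lborel f"
    by (intro integrable_lborel_bounded_support[OF _ _ supp, where M="\<bar>K\<bar>"]) auto
  \<comment> \<open>Ratios above 1 expand away from \<open>c\<close>, so points outside the ball
    stay outside and \<open>s n\<close> vanishes there.\<close>
  have far: "c + (1 + d n) *\<^sub>R (x - c) \<notin> cball c R" if "x \<notin> cball c R" for n x
  proof -
    have "norm (x - c) \<le> (1 + d n) * norm (x - c)"
      using dpos[of n] by (simp add: mult_le_cancel_right1)
    then show ?thesis using that dpos[of n] by (simp add: dist_norm norm_minus_commute)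
  qed
  have intf': "integrable lborel (\<lambda>x. f (c + (1 + d n) *\<^sub>R (x - c)))" for n
    using \<open>\<And>x. \<bar>f x\<bar> \<le> \<bar>K\<bar>\<close> far supp
    by (intro integrable_lborel_bounded_support[where M="\<bar>K\<bar>" and c=c and R=R]) auto
  \<comment> \<open>First evaluation: pointwise, \<open>s n x\<close> tends to the derivative of
    \<open>f\<close> in direction \<open>x - c\<close>; the limit passes through the integral by
    domination.\<close>
  have "(\<lambda>n. \<integral>x. s n x \<partial>lborel) \<longlonglongrightarrow> (\<integral>x. G x \<bullet> (x - c) \<partial>lborel)"
  proof (rule integral_dominated_convergence)
    show "integrable lborel (\<lambda>x. M * R * indicator (cball c R) x :: real)"
      by (intro integrable_mult_right integrable_real_indicator) (simp_all add: emeasure_lborel_cball_finite[simplified])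
    show "AE x in lborel. (\<lambda>n. s n x) \<longlonglongrightarrow> G x \<bullet> (x - c)"
    proof (intro AE_I2)
      fix x
      have "((\<lambda>h. f (c + (1 + h) *\<^sub>R (x - c))) has_derivative (\<lambda>h. G x \<bullet> (h *\<^sub>R (x - c)))) (at 0)"
      proof (rule has_derivative_compose[where f="\<lambda>h. c + (1 + h) *\<^sub>R (x - c)"])
        show "((\<lambda>h::real. c + (1 + h) *\<^sub>R (x - c)) has_derivative (\<lambda>h. h *\<^sub>R (x - c))) (at 0)"
          by (auto intro!: derivative_eq_intros)
      qed (simp add: deriv)
      then have "((\<lambda>h. f (c + (1 + h) *\<^sub>R (x - c))) has_real_derivative G x \<bullet> (x - c)) (at 0)"
        by (simp add: has_field_derivative_def mult_commute_abs)
      then have "((\<lambda>h. (f (c + (1 + h) *\<^sub>R (x - c)) - f x) / h) \<longlongrightarrow> G x \<bullet> (x - c)) (at 0)"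
        by (simp add: DERIV_def)
      from filterlim_compose[OF this d]
      show "(\<lambda>n. s n x) \<longlonglongrightarrow> G x \<bullet> (x - c)" by (simp add: s_def)
    qed
    show "AE x in lborel. norm (s n x) \<le> M * R * indicator (cball c R) x" for n
    proof (intro AE_I2)
      fix x
      show "norm (s n x) \<le> M * R * indicator (cball c R) x"
      proof (cases "x \<in> cball c R")
        case True
        have "c + (1 + d n) *\<^sub>R (x - c) - x = d n *\<^sub>R (x - c)" by (simp add: algebra_simps)
        then have "\<bar>f (c + (1 + d n) *\<^sub>R (x - c)) - f x\<bar> \<le> M * (d n * norm (x - c))"
          using lip[of "c + (1 + d n) *\<^sub>R (x - c)" x] dpos[of n] by simp
        also have "\<dots> \<le> M * (d n * R)"
          using True M dpos[of n] by (intro mult_left_mono) (auto simp: dist_norm norm_minus_commute)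
        finally show ?thesis using True dpos[of n] by (simp add: s_def divide_le_eq mult_ac)
      next
        case False
        then show ?thesis using far[OF False] by (simp add: s_def supp)
      qed
    qed
  qed (simp_all add: s_def)
  \<comment> \<open>Second evaluation: changing variables first leaves the difference quotient of
    \<open>1 / t ^ DIM('a)\<close> at \<open>t = 1\<close>, whose limit is
    \<open>- DIM('a)\<close>.\<close>
  moreover have "(\<lambda>n. \<integral>x. s n x \<partial>lborel) \<longlonglongrightarrow> - real DIM('a) * (\<integral>x. f x \<partial>lborel)"
  proof -
    have "((\<lambda>t::real. 1 / t ^ DIM('a)) has_real_derivative - real DIM('a)) (at 1)"
      by (auto intro!: derivative_eq_intros)
    then have "((\<lambda>h::real. (1 / (1 + h) ^ DIM('a) - 1) / h) \<longlongrightarrow> - real DIM('a)) (at 0)"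
      by (simp add: DERIV_def)
    from tendsto_mult[OF filterlim_compose[OF this d] tendsto_const]
    have "(\<lambda>n. (1 / (1 + d n) ^ DIM('a) - 1) / d n * (\<integral>x. f x \<partial>lborel)) \<longlonglongrightarrow> - real DIM('a) * (\<integral>x. f x \<partial>lborel)" .
    moreover have "(\<integral>x. s n x \<partial>lborel) = (1 / (1 + d n) ^ DIM('a) - 1) / d n * (\<integral>x. f x \<partial>lborel)" for n
      using dpos[of n] integral_lborel_dilation[of f "1 + d n" c]
      by (simp add: s_def intf intf' left_diff_distrib diff_divide_distrib)
    ultimately show ?thesis by simp
  qed
  ultimately show ?thesis by (rule LIMSEQ_unique)
qed

text \<open>The set witnessing smoothness contains all directional derivatives of
  \<open>\<psi>\<close>. By uniqueness of derivatives these are the functions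
  \<open>G x \<bullet> v\<close>, and each member of the set is differentiable, hence
  continuous.\<close>

lemma test_fun_continuous:
  assumes "test_fun \<Omega> \<psi> G"
  shows "continuous_on UNIV \<psi>" "continuous_on UNIV G"
proof -
  have d: "\<And>x. (\<psi> has_derivative (\<lambda>h. G x \<bullet> h)) (at x)" and "smooth_fun \<psi>"
    using assms by (auto simp: test_fun_def)
  then show "continuous_on UNIV \<psi>"
    by (intro continuous_at_imp_continuous_on ballI) (rule has_derivative_continuous)
  from \<open>smooth_fun \<psi>\<close> obtain S where S: "\<psi> \<in> S"
    "\<forall>g\<in>S. \<exists>g'. (\<forall>x. (g has_derivative g' x) (at x)) \<and> (\<forall>v. (\<lambda>x. g' x v) \<in> S)"
    unfolding smooth_fun_def by blast
  then obtain g' where g': "\<And>x. (\<psi> has_derivative g' x) (at x)" "\<And>v. (\<lambda>x. g' x v) \<in> S"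
    by blast
  have "continuous_on UNIV (\<lambda>x. G x \<bullet> v)" for v
  proof -
    have "(\<lambda>x. G x \<bullet> v) = (\<lambda>x. g' x v)"
      using has_derivative_unique[OF d g'(1)] by (metis (no_types, opaque_lifting))
    then have "(\<lambda>x. G x \<bullet> v) \<in> S" using g'(2) by simp
    then show ?thesis
      using S(2) has_derivative_continuous continuous_at_imp_continuous_on by metis
  qed
  then show "continuous_on UNIV G"
    by (simp add: continuous_on_componentwise[where f=G])
qed

text \<open>The radial identity applies to \<open>\<psi>\<close> cut off by the indicator of the
  ball. The cut-off stays differentiable because the compact support lies in two disjoint open sets.
  Divided by \<open>- DIM('a)\<close>, this is the weak torsion equation on one ball.\<close>

lemma integral_test_fun_ball:
  fixes c :: "'a::euclidean_space"
  assumes \<psi>: "test_fun (ball c r \<union> V) \<psi> G" and V: "open V" "ball c r \<inter> V = {}"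
  shows "(\<integral>x. indicator (ball c r) x * (G x \<bullet> (x - c)) \<partial>lborel) =
    - real DIM('a) * (\<integral>x. indicator (ball c r) x * \<psi> x \<partial>lborel)"
proof -
  let ?B = "ball c r" and ?K = "closure {x. \<psi> x \<noteq> 0}"
  have d: "\<And>x. (\<psi> has_derivative (\<lambda>h. G x \<bullet> h)) (at x)" and K: "compact ?K" "?K \<subseteq> ?B \<union> V"
    using \<psi> by (auto simp: test_fun_def)
  note cont = test_fun_continuous[OF \<psi>]
  have 1: "((\<lambda>x. indicator ?B x * \<psi> x) has_derivative (\<lambda>h. (indicator ?B x *\<^sub>R G x) \<bullet> h)) (at x)" for x
  proof (cases "x \<in> ?B")
    case True
    have "((\<lambda>x. indicator ?B x * \<psi> x) has_derivative (\<lambda>h. G x \<bullet> h)) (at x)"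
      by (rule has_derivative_transform_within_open[OF d, where s="?B"]) (use True in auto)
    then show ?thesis using True by simp
  next
    case False
    \<comment> \<open>Removing the open set \<open>V\<close> shows that the part of the support
      inside the ball is closed; hence the cut-off function vanishes near every point outside the
      ball.\<close>
    have "?K - V = ?K \<inter> ?B" using K V by auto
    then have "closed (?K \<inter> ?B)" using V by (metis closed_Diff closed_closure)
    have "((\<lambda>x. indicator ?B x * \<psi> x) has_derivative (\<lambda>h. 0)) (at x)"
    proof (rule has_derivative_transform_within_open[OF has_derivative_const])
      show "open (- (?K \<inter> ?B))" using \<open>closed (?K \<inter> ?B)\<close> by (rule open_Compl)
      show "0 = indicator ?B y * \<psi> y" if "y \<in> - (?K \<inter> ?B)" for y
        using that closure_subset[of "{x. \<psi> x \<noteq> 0}"] by (auto simp: indicator_def)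
    qed (use False in auto)
    then show ?thesis using False by simp
  qed
  have "bounded (G ` cball c r)"
    by (intro compact_imp_bounded compact_continuous_image continuous_on_subset[OF cont(2)]) auto
  then obtain M where M: "\<And>x. x \<in> cball c r \<Longrightarrow> norm (G x) \<le> M"
    unfolding bounded_iff by (auto simp del: mem_cball)
  have "norm (indicator ?B x *\<^sub>R G x) \<le> \<bar>M\<bar>" for x
    using M[of x] by (cases "x \<in> ?B") auto
  from integral_radial_derivative[OF 1 this, of c r] show ?thesis
    using cont(2)[THEN borel_measurable_continuous_onI] by simp
qed

section \<open>The torsion function of a finite union of balls\<close>

text \<open>Since \<open>(x - c) \<bullet> (x - c)\<close> has Laplacian \<open>2 * DIM('a)\<close>,
  the divisor makes minus the Laplacian equal to 1. The function vanishes on the sphere of radius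
  \<open>r\<close>.\<close>

definition paraboloid :: "'a::euclidean_space \<Rightarrow> real \<Rightarrow> 'a \<Rightarrow> real" where
  "paraboloid c r x = (r\<^sup>2 - (x - c) \<bullet> (x - c)) / (2 * real DIM('a))"

lemma paraboloid_pos_iff:
  assumes "0 < r"
  shows "0 < paraboloid c r x \<longleftrightarrow> x \<in> ball c r"
proof -
  have "0 < paraboloid c r x \<longleftrightarrow> (norm (x - c))\<^sup>2 < r\<^sup>2"
    by (simp add: paraboloid_def zero_less_divide_iff power2_norm_eq_inner)
  also have "\<dots> \<longleftrightarrow> x \<in> ball c r"
    using assms by (auto simp: dist_norm norm_minus_commute power_strict_mono dest: power2_less_imp_less)
  finally show ?thesis .
qed

lemma paraboloid_le: "paraboloid c r x \<le> r\<^sup>2"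
  for c :: "'a::euclidean_space"
proof -
  have "r\<^sup>2 \<le> r\<^sup>2 * (2 * real DIM('a))"
    using DIM_ge_Suc0[where 'a='a]
    by (simp add: mult_le_cancel_left1 del: DIM_ge_Suc0)
  moreover have "0 \<le> (x - c) \<bullet> (x - c)" by simp
  ultimately show ?thesis
    unfolding paraboloid_def by (intro divide_le_eq[THEN iffD2]) (simp del: inner_ge_zero)
qed

lemma continuous_on_paraboloid: "continuous_on UNIV (paraboloid c r)"
  unfolding paraboloid_def by (auto intro!: continuous_intros)

lemma has_derivative_paraboloid:
  fixes c :: "'a::euclidean_space"
  shows "(paraboloid c r has_derivative (\<lambda>h. - (1 / real DIM('a)) * ((x - c) \<bullet> h))) (at x)"
  unfolding paraboloid_def
  by (auto intro!: derivative_eq_intros simp: inner_commute field_simps)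

text \<open>A sum of positive parts avoids choosing the ball that contains \<open>x\<close>: for
  disjoint balls at most one summand is nonzero.\<close>

definition ball_torsion :: "'i set \<Rightarrow> ('i \<Rightarrow> 'a::euclidean_space) \<Rightarrow> ('i \<Rightarrow> real) \<Rightarrow> 'a \<Rightarrow> real" where
  "ball_torsion I c r x = (\<Sum>i\<in>I. max 0 (paraboloid (c i) (r i) x))"

text \<open>Indicators of open balls fix the value 0 on the bounding spheres, where the positive
  parts have a kink.\<close>

definition ball_torsion_grad :: "'i set \<Rightarrow> ('i \<Rightarrow> 'a::euclidean_space) \<Rightarrow> ('i \<Rightarrow> real) \<Rightarrow> 'a \<Rightarrow> 'a" where
  "ball_torsion_grad I c r x =
     - (1 / real DIM('a)) *\<^sub>R (\<Sum>i\<in>I. indicator (ball (c i) (r i)) x *\<^sub>R (x - c i))"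

lemma ball_torsion_borel [measurable]: "ball_torsion I c r \<in> borel_measurable borel"
  unfolding ball_torsion_def
  by (intro borel_measurable_continuous_onI continuous_intros continuous_on_paraboloid)

lemma ball_torsion_grad_borel [measurable]: "ball_torsion_grad I c r \<in> borel_measurable borel"
  unfolding ball_torsion_grad_def[abs_def] by measurable

lemma ball_torsion_nonneg: "0 \<le> ball_torsion I c r x"
  unfolding ball_torsion_def by (intro sum_nonneg) auto

lemma ball_torsion_eq_0:
  assumes "\<And>i. i \<in> I \<Longrightarrow> 0 < r i" "x \<notin> (\<Union>i\<in>I. ball (c i) (r i))"
  shows "ball_torsion I c r x = 0" "ball_torsion_grad I c r x = 0"
proof -
  have "paraboloid (c i) (r i) x \<le> 0" if "i \<in> I" for i
    using paraboloid_pos_iff[OF assms(1)[OF that], of "c i" x] assms(2) that by (force simp: not_less)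
  then show "ball_torsion I c r x = 0" unfolding ball_torsion_def by (intro sum.neutral) auto
  show "ball_torsion_grad I c r x = 0"
    using assms(2) unfolding ball_torsion_grad_def by (auto simp: indicator_def intro!: sum.neutral)
qed

lemma ball_torsion_eq:
  assumes "finite I" "disjoint_family_on (\<lambda>i. ball (c i) (r i)) I" "\<And>i. i \<in> I \<Longrightarrow> 0 < r i"
    and k: "k \<in> I" "x \<in> ball (c k) (r k)"
  shows "ball_torsion I c r x = paraboloid (c k) (r k) x"
proof -
  have "max 0 (paraboloid (c i) (r i) x) = 0" if "i \<in> I - {k}" for i
  proof -
    have "x \<notin> ball (c i) (r i)" using assms(2) k that by (force simp: disjoint_family_on_def)
    then show ?thesis using paraboloid_pos_iff[OF assms(3), of i "c i" x] that by (simp add: not_less)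
  qed
  then show ?thesis
    using paraboloid_pos_iff[OF assms(3)[OF k(1)], of "c k" x] k assms(1)
    unfolding ball_torsion_def by (subst sum.remove[of _ k]) auto
qed

section \<open>Membership in \<open>H01\<close> and the weak equation\<close>

text \<open>Because of the shift by \<open>d\<close>, the i-th summand vanishes wherever its
  paraboloid is at most \<open>d\<close>. The support therefore lies in the compact superlevel sets
  at height \<open>d\<close>, which are inside the open balls.\<close>

lemma test_fun_soft_paraboloids:
  fixes c :: "'i \<Rightarrow> 'a::euclidean_space"
  assumes "finite I" "0 < d" "\<And>i. i \<in> I \<Longrightarrow> 0 < r i"
  shows "test_fun (\<Union>i\<in>I. ball (c i) (r i))
    (\<lambda>x. \<Sum>i\<in>I. soft_pos d (paraboloid (c i) (r i) x - d))
    (\<lambda>x. - (1 / real DIM('a)) *\<^sub>R (\<Sum>i\<in>I. soft_step d (paraboloid (c i) (r i) x - d) *\<^sub>R (x - c i)))"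
    (is "test_fun _ ?\<phi> ?G")
  unfolding test_fun_def
proof (intro conjI allI)
  have "(\<lambda>x. soft_pos d (paraboloid (c i) (r i) x - d)) \<in> flat_algebra d" for i
  proof -
    let ?a = "(r i)\<^sup>2 / (2 * real DIM('a)) - d" and ?b = "1 / (2 * real DIM('a))"
    have *: "paraboloid (c i) (r i) x - d = ?a - ?b * ((x - c i) \<bullet> (x - c i))" for x
      by (simp add: paraboloid_def diff_divide_distrib)
    \<comment> \<open>\<open>soft_pos\<close> contains its argument as a factor, so the quadratic
      itself must lie in the algebra; expanding it exposes the generators \<open>inner\<close> and
      \<open>square\<close>.\<close>
    have **: "(x - c i) \<bullet> (x - c i) = x \<bullet> x - 2 * (x \<bullet> c i) + c i \<bullet> c i" for x
      by (simp add: inner_diff_left inner_diff_right inner_commute)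
    have "(\<lambda>x. ?a - ?b * ((x - c i) \<bullet> (x - c i))) \<in> flat_algebra d"
      unfolding **
      by (intro flat_algebra_diff flat_algebra.add flat_algebra.mult flat_algebra.const
            flat_algebra.inner flat_algebra.square)
    then show ?thesis
      unfolding soft_pos_def * by (intro flat_algebra.mult flat_algebra.flat)
  qed
  then show "smooth_fun ?\<phi>"
    by (intro smooth_fun_flat_algebra[OF assms(2)] flat_algebra_sum)
next
  fix x
  have "((\<lambda>x. soft_pos d (paraboloid (c i) (r i) x - d)) has_derivative
      (\<lambda>h. soft_step d (paraboloid (c i) (r i) x - d) * (- (1 / real DIM('a)) * ((x - c i) \<bullet> h)))) (at x)" for i
    using has_derivative_compose[OF has_derivative_diff[OF has_derivative_paraboloid has_derivative_const]
        has_derivative_soft_pos[OF assms(2), unfolded has_field_derivative_def]]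
    by simp
  then have "(?\<phi> has_derivative (\<lambda>h. \<Sum>i\<in>I. soft_step d (paraboloid (c i) (r i) x - d) * (- (1 / real DIM('a)) * ((x - c i) \<bullet> h)))) (at x)"
    by (intro has_derivative_sum)
  then show "(?\<phi> has_derivative (\<lambda>h. ?G x \<bullet> h)) (at x)"
    by (simp add: inner_sum_left sum_distrib_left sum_negf mult_ac sum_divide_distrib)
next
  let ?K = "\<Union>i\<in>I. {x. d \<le> paraboloid (c i) (r i) x}"
  have sub: "{x. d \<le> paraboloid (c i) (r i) x} \<subseteq> ball (c i) (r i)" if "i \<in> I" for i
    using paraboloid_pos_iff[OF assms(3)[OF that], of "c i"] assms(2) by force
  have "closed {x. d \<le> paraboloid (c i) (r i) x}" for i
    by (intro closed_Collect_le continuous_on_paraboloid continuous_on_const)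
  then have "compact ?K"
    using assms(1)
    by (intro compact_UN) (auto simp: compact_eq_bounded_closed intro: bounded_subset[OF bounded_ball sub])
  have "?\<phi> x = 0" if "x \<notin> ?K" for x
    using that by (intro sum.neutral ballI soft_eq_0) auto
  then have "{x. ?\<phi> x \<noteq> 0} \<subseteq> ?K" by auto
  then have cl: "closure {x. ?\<phi> x \<noteq> 0} \<subseteq> ?K"
    using \<open>compact ?K\<close> by (intro closure_minimal compact_imp_closed)
  show "compact (closure {x. ?\<phi> x \<noteq> 0})"
    using bounded_subset[OF compact_imp_bounded[OF \<open>compact ?K\<close>] cl]
    unfolding compact_eq_bounded_closed by (intro conjI closed_closure)
  show "closure {x. ?\<phi> x \<noteq> 0} \<subseteq> (\<Union>i\<in>I. ball (c i) (r i))"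
    by (rule order_trans[OF cl UN_mono[OF subset_refl sub]])
qed

lemma integral_dominated_null_lebesgue:
  fixes F :: "nat \<Rightarrow> 'a::euclidean_space \<Rightarrow> real"
  assumes "\<And>n. F n \<in> borel_measurable borel" "integrable lborel w" "\<And>n x. \<bar>F n x\<bar> \<le> w x"
    and "\<And>x. (\<lambda>n. F n x) \<longlonglongrightarrow> 0"
  shows "(\<lambda>n. \<integral>x. F n x \<partial>lebesgue) \<longlonglongrightarrow> 0"
proof -
  have "(\<lambda>n. \<integral>x. F n x \<partial>lborel) \<longlonglongrightarrow> (\<integral>x. 0 \<partial>(lborel :: 'a measure))"
    using assms by (intro integral_dominated_convergence[where w=w]) auto
  then show ?thesis using assms(1) by (simp add: integral_completion)
qed

text \<open>The approximants increase no value: they lie between 0 and the limit, so the squared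
  error is at most the square of the limit. For the gradients a common majorant \<open>w\<close> is
  used, and dominated convergence gives both limits.\<close>

lemma H01_ball_torsion:
  fixes c :: "'i \<Rightarrow> 'a::euclidean_space"
  assumes "finite I" and r: "\<And>i. i \<in> I \<Longrightarrow> 0 < r i"
  shows "H01 (\<Union>i\<in>I. ball (c i) (r i)) (ball_torsion I c r) (ball_torsion_grad I c r)"
proof -
  let ?\<Omega> = "\<Union>i\<in>I. ball (c i) (r i)" and ?v = "ball_torsion I c r" and ?g = "ball_torsion_grad I c r"
  define d where "d = (\<lambda>n. inverse (real (Suc n)))"
  have dpos: "0 < d n" for n by (simp add: d_def)
  define \<phi> where "\<phi> = (\<lambda>n x. \<Sum>i\<in>I. soft_pos (d n) (paraboloid (c i) (r i) x - d n))"
  define G where "G = (\<lambda>n x. - (1 / real DIM('a)) *\<^sub>R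
    (\<Sum>i\<in>I. soft_step (d n) (paraboloid (c i) (r i) x - d n) *\<^sub>R (x - c i)))"
  have test: "test_fun ?\<Omega> (\<phi> n) (G n)" for n
    unfolding \<phi>_def G_def using test_fun_soft_paraboloids[OF assms(1) dpos r] by simp
  note meas [measurable] = test_fun_continuous[OF test, THEN borel_measurable_continuous_onI]
  \<comment> \<open>On the i-th ball \<open>norm (x - c i)\<close> is below \<open>r i\<close>, so
    \<open>w\<close> majorizes every gradient-like sum whose coefficients are bounded by the
    indicators.\<close>
  define w where "w = (\<lambda>x. \<Sum>i\<in>I. indicator (ball (c i) (r i)) x * r i)"
  have [measurable]: "w \<in> borel_measurable borel" unfolding w_def by measurable
  have "bounded ?\<Omega>" using assms(1) by (intro bounded_UN) auto
  then obtain R where R: "?\<Omega> \<subseteq> cball 0 R"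
    unfolding bounded_iff by (metis mem_cball_0 subsetI)
  have out: "x \<notin> ?\<Omega>" if "x \<notin> cball 0 R" for x
    using R that by (rule contra_subsetD)
  have "?v x \<le> (\<Sum>i\<in>I. (r i)\<^sup>2)" for x
    unfolding ball_torsion_def by (intro sum_mono) (simp add: paraboloid_le)
  then have "\<bar>(?v x)\<^sup>2\<bar> \<le> (\<Sum>i\<in>I. (r i)\<^sup>2)\<^sup>2" for x
    by (simp add: power_mono ball_torsion_nonneg)
  moreover have "(?v x)\<^sup>2 = 0" if "x \<notin> cball 0 R" for x
    using ball_torsion_eq_0(1)[OF r out[OF that]] by simp
  ultimately have int_v: "integrable lborel (\<lambda>x. (?v x)\<^sup>2)"
    by (intro integrable_lborel_bounded_support[where c=0 and R=R]) auto
  have w0: "0 \<le> w x" for x unfolding w_def using r by (intro sum_nonneg) (auto simp: less_imp_le)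
  have "w x \<le> (\<Sum>i\<in>I. r i)" for x
    unfolding w_def using r by (intro sum_mono) (auto simp: indicator_def less_imp_le)
  then have "\<bar>(w x)\<^sup>2\<bar> \<le> (\<Sum>i\<in>I. r i)\<^sup>2" for x
    by (simp add: power_mono w0)
  moreover have "(w x)\<^sup>2 = 0" if "x \<notin> cball 0 R" for x
  proof -
    have "w x = 0"
      unfolding w_def using out[OF that] by (intro sum.neutral) (auto simp: indicator_def)
    then show ?thesis by simp
  qed
  ultimately have int_w: "integrable lborel (\<lambda>x. (w x)\<^sup>2)"
    by (intro integrable_lborel_bounded_support[where c=0 and R=R]) auto
  \<comment> \<open>Used with the indicators as \<open>a\<close> for the limit gradient, and with
    soft steps minus indicators for the error.\<close>
  have comb: "norm (- (1 / real DIM('a)) *\<^sub>R (\<Sum>i\<in>I. a i *\<^sub>R (x - c i))) \<le> w x"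
    if a: "\<And>i. i \<in> I \<Longrightarrow> \<bar>a i\<bar> \<le> indicator (ball (c i) (r i)) x" for a x
  proof -
    have "norm (\<Sum>i\<in>I. a i *\<^sub>R (x - c i)) \<le> w x"
      unfolding w_def
    proof (rule sum_norm_le)
      fix i assume "i \<in> I"
      show "norm (a i *\<^sub>R (x - c i)) \<le> indicator (ball (c i) (r i)) x * r i"
        using a[OF \<open>i \<in> I\<close>] mult_mono[of "\<bar>a i\<bar>" 1 "norm (x - c i)" "r i"]
        by (auto simp: indicator_def dist_norm norm_minus_commute split: if_splits)
    qed
    moreover have "norm (- (1 / real DIM('a)) *\<^sub>R y) \<le> norm y" for y :: 'a
      using DIM_positive[where 'a='a] by (simp add: divide_le_eq mult_le_cancel_left1)
    ultimately show ?thesis using order_trans by blast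
  qed
  have step: "0 \<le> soft_step (d n) (paraboloid (c i) (r i) x - d n)"
    "soft_step (d n) (paraboloid (c i) (r i) x - d n) \<le> indicator (ball (c i) (r i)) x"
    if "i \<in> I" for i n x
    using soft_step_bounds[OF dpos, of n] soft_eq_0(2)[of "paraboloid (c i) (r i) x - d n"]
      paraboloid_pos_iff[OF r[OF that], of "c i" x] dpos[of n]
    by (auto simp: indicator_def)
  show ?thesis
    unfolding H01_def
  proof (intro conjI exI allI)
    show "integrable lebesgue (\<lambda>x. (?v x)\<^sup>2)" using int_v by (simp add: integrable_completion)
    have "norm (?g x) \<le> w x" for x
      unfolding ball_torsion_grad_def by (rule comb) auto
    then have "integrable lborel (\<lambda>x. (norm (?g x))\<^sup>2)"
      by (intro Bochner_Integration.integrable_bound[OF int_w]) (auto intro!: AE_I2 power_mono)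
    then show "integrable lebesgue (\<lambda>x. (norm (?g x))\<^sup>2)" by (simp add: integrable_completion)
    show "test_fun ?\<Omega> (\<phi> n) (G n)" for n by (rule test)
    show "(\<lambda>n. \<integral>x. (\<phi> n x - ?v x)\<^sup>2 \<partial>lebesgue) \<longlonglongrightarrow> 0"
    proof (rule integral_dominated_null_lebesgue[OF _ int_v])
      fix x n
      have "0 \<le> \<phi> n x" unfolding \<phi>_def by (intro sum_nonneg soft_pos_bounds dpos)
      moreover have "\<phi> n x \<le> ?v x" unfolding \<phi>_def ball_torsion_def
      proof (rule sum_mono)
        fix i
        show "soft_pos (d n) (paraboloid (c i) (r i) x - d n) \<le> max 0 (paraboloid (c i) (r i) x)"
          using soft_pos_bounds(2)[OF dpos, of n "paraboloid (c i) (r i) x - d n"] dpos[of n] by linarith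
      qed
      ultimately have "\<bar>\<phi> n x - ?v x\<bar> \<le> \<bar>?v x\<bar>" by linarith
      then show "\<bar>(\<phi> n x - ?v x)\<^sup>2\<bar> \<le> (?v x)\<^sup>2" by (simp add: abs_le_square_iff)
    next
      fix x
      have "(\<lambda>n. \<phi> n x) \<longlonglongrightarrow> ?v x"
        unfolding \<phi>_def ball_torsion_def d_def by (intro tendsto_sum tendsto_soft)
      then have "(\<lambda>n. (\<phi> n x - ?v x)\<^sup>2) \<longlonglongrightarrow> (?v x - ?v x)\<^sup>2" by (intro tendsto_intros)
      then show "(\<lambda>n. (\<phi> n x - ?v x)\<^sup>2) \<longlonglongrightarrow> 0" by simp
    qed simp
    show "(\<lambda>n. \<integral>x. (norm (G n x - ?g x))\<^sup>2 \<partial>lebesgue) \<longlonglongrightarrow> 0"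
    proof (rule integral_dominated_null_lebesgue[OF _ int_w])
      fix x n
      have "G n x - ?g x = - (1 / real DIM('a)) *\<^sub>R (\<Sum>i\<in>I.
         (soft_step (d n) (paraboloid (c i) (r i) x - d n) - indicator (ball (c i) (r i)) x) *\<^sub>R (x - c i))"
        unfolding G_def ball_torsion_grad_def
        by (simp add: scaleR_diff_left sum_subtractf scaleR_diff_right)
      also have "norm \<dots> \<le> w x"
        using step by (intro comb) (force simp: abs_le_iff intro: order_trans[of _ 0])
      finally show "\<bar>(norm (G n x - ?g x))\<^sup>2\<bar> \<le> (w x)\<^sup>2" by (simp add: power_mono)
    next
      fix x
      \<comment> \<open>The paraboloid is positive exactly on the open ball, so the limit is the
        indicator at every point, the sphere included.\<close>
      have "(\<lambda>n. soft_step (d n) (paraboloid (c i) (r i) x - d n)) \<longlonglongrightarrow> indicator (ball (c i) (r i)) x"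
        if "i \<in> I" for i
        using tendsto_soft(2)[of "paraboloid (c i) (r i) x"] paraboloid_pos_iff[OF r[OF that], of "c i" x]
        by (auto simp: d_def indicator_def split: if_splits)
      then have "(\<lambda>n. G n x) \<longlonglongrightarrow> ?g x"
        unfolding G_def ball_torsion_grad_def by (intro tendsto_sum tendsto_scaleR tendsto_const)
      then have "(\<lambda>n. (norm (G n x - ?g x))\<^sup>2) \<longlonglongrightarrow> (norm (?g x - ?g x))\<^sup>2" by (intro tendsto_intros)
      then show "(\<lambda>n. (norm (G n x - ?g x))\<^sup>2) \<longlonglongrightarrow> 0" by simp
    qed simp
  qed (simp_all add: measurable_completion)
qed

text \<open>The weak equation splits into one identity per ball. On each ball the gradient is
  \<open>- (x - c i) / DIM('a)\<close>, and the radial identity contributes the factor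
  \<open>- DIM('a)\<close> that cancels the constant.\<close>

lemma torsion_ball_torsion:
  fixes c :: "'i \<Rightarrow> 'a::euclidean_space"
  assumes "finite I" and r: "\<And>i. i \<in> I \<Longrightarrow> 0 < r i"
    and disj: "disjoint_family_on (\<lambda>i. ball (c i) (r i)) I"
  shows "torsion (\<Union>i\<in>I. ball (c i) (r i)) (ball_torsion I c r) (ball_torsion_grad I c r)"
  unfolding torsion_def
proof (intro conjI allI impI H01_ball_torsion assms)
  let ?\<Omega> = "\<Union>i\<in>I. ball (c i) (r i)"
  let ?m = "real DIM('a)"
  fix \<psi> :: "'a \<Rightarrow> real" and G assume \<psi>: "test_fun ?\<Omega> \<psi> G"
  note cont = test_fun_continuous[OF \<psi>]
  note [measurable] = cont[THEN borel_measurable_continuous_onI]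
  have int: "integrable lborel (\<lambda>x. indicator (ball (c i) (r i)) x * f x)"
    if f: "continuous_on UNIV f" for i and f :: "'a \<Rightarrow> real"
  proof -
    have "bounded (f ` cball (c i) (r i))"
      by (intro compact_imp_bounded compact_continuous_image continuous_on_subset[OF f]) auto
    then obtain M where M: "\<And>x. x \<in> cball (c i) (r i) \<Longrightarrow> \<bar>f x\<bar> \<le> M"
      unfolding bounded_iff by (auto simp del: mem_cball)
    have "\<bar>indicator (ball (c i) (r i)) x * f x\<bar> \<le> \<bar>M\<bar>" for x
      using M[of x] by (cases "x \<in> ball (c i) (r i)") auto
    then show ?thesis
      using f[THEN borel_measurable_continuous_onI]
      by (intro integrable_lborel_bounded_support[where M="\<bar>M\<bar>" and c="c i" and R="r i"]) auto
  qed
  have 1: "(\<integral>x. indicator (ball (c i) (r i)) x * (G x \<bullet> (x - c i)) \<partial>lborel) =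
     - ?m * (\<integral>x. indicator (ball (c i) (r i)) x * \<psi> x \<partial>lborel)" if "i \<in> I" for i
  \<comment> \<open>The union of all other balls plays the role of \<open>V\<close>.\<close>
  proof (rule integral_test_fun_ball)
    show "test_fun (ball (c i) (r i) \<union> (\<Union>j\<in>I - {i}. ball (c j) (r j))) \<psi> G"
      using \<psi> that by (metis UN_insert insert_Diff)
    show "ball (c i) (r i) \<inter> (\<Union>j\<in>I - {i}. ball (c j) (r j)) = {}"
      using disj that unfolding disjoint_family_on_def by blast
  qed auto
  have "(\<lambda>x. indicator ?\<Omega> x *\<^sub>R (ball_torsion_grad I c r x \<bullet> G x)) =
      (\<lambda>x. \<Sum>i\<in>I. - (1 / ?m) * (indicator (ball (c i) (r i)) x * (G x \<bullet> (x - c i))))"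
  proof
    fix x
    have "indicator ?\<Omega> x *\<^sub>R (ball_torsion_grad I c r x \<bullet> G x) = ball_torsion_grad I c r x \<bullet> G x"
      using ball_torsion_eq_0(2)[of I r x c] r by (cases "x \<in> ?\<Omega>") auto
    also have "\<dots> = (\<Sum>i\<in>I. - (1 / ?m) * (indicator (ball (c i) (r i)) x * (G x \<bullet> (x - c i))))"
      unfolding ball_torsion_grad_def
      by (simp add: inner_sum_right sum_distrib_left sum_negf inner_commute[of _ "G x"] sum_divide_distrib)
    finally show "indicator ?\<Omega> x *\<^sub>R (ball_torsion_grad I c r x \<bullet> G x) =
      (\<Sum>i\<in>I. - (1 / ?m) * (indicator (ball (c i) (r i)) x * (G x \<bullet> (x - c i))))" .
  qed
  then have "(\<integral>x\<in>?\<Omega>. ball_torsion_grad I c r x \<bullet> G x \<partial>lebesgue) =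
      (\<integral>x. (\<Sum>i\<in>I. - (1 / ?m) * (indicator (ball (c i) (r i)) x * (G x \<bullet> (x - c i)))) \<partial>lborel)"
    unfolding set_lebesgue_integral_def by (simp add: integral_completion)
  also have "\<dots> = (\<Sum>i\<in>I. - (1 / ?m) * (\<integral>x. indicator (ball (c i) (r i)) x * (G x \<bullet> (x - c i)) \<partial>lborel))"
    by (subst Bochner_Integration.integral_sum)
       (auto intro!: integrable_mult_right int continuous_intros cont)
  also have "\<dots> = (\<Sum>i\<in>I. \<integral>x. indicator (ball (c i) (r i)) x * \<psi> x \<partial>lborel)"
    by (intro sum.cong refl) (simp add: 1)
  also have "\<dots> = (\<integral>x. (\<Sum>i\<in>I. indicator (ball (c i) (r i)) x * \<psi> x) \<partial>lborel)"
    by (subst Bochner_Integration.integral_sum) (auto intro!: int cont)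
  \<comment> \<open>Disjointness makes the indicators of the balls add up to that of the
    union.\<close>
  also have "\<dots> = (\<integral>x. indicator ?\<Omega> x * \<psi> x \<partial>lborel)"
    by (simp add: indicator_UN_disjoint[OF assms(1) disj] sum_distrib_right)
  also have "\<dots> = (\<integral>x\<in>?\<Omega>. \<psi> x \<partial>lebesgue)"
    unfolding set_lebesgue_integral_def using assms(1) by (simp add: integral_completion)
  finally show "(\<integral>x\<in>?\<Omega>. ball_torsion_grad I c r x \<bullet> G x \<partial>lebesgue) = (\<integral>x\<in>?\<Omega>. \<psi> x \<partial>lebesgue)" .
qed

section \<open>Bounds for the first eigenvalue\<close>

lemma H01_mono:
  assumes "H01 \<Omega> u g" "\<Omega> \<subseteq> \<Omega>'"
  shows "H01 \<Omega>' u g"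
proof -
  have "test_fun \<Omega>' \<phi> G" if "test_fun \<Omega> \<phi> G" for \<phi> G
    using that assms(2) unfolding test_fun_def by blast
  then show ?thesis using assms(1) unfolding H01_def by meson
qed

text \<open>The quotient of one trial function, the torsion function of a single ball (a one-element
  index set). It need not equal the first eigenvalue; only its independence of the surrounding
  domain matters.\<close>

definition ball_rayleigh :: "'a::euclidean_space \<Rightarrow> real \<Rightarrow> real" where
  "ball_rayleigh c r =
     (\<integral>x. (norm (ball_torsion_grad {()} (\<lambda>_. c) (\<lambda>_. r) x))\<^sup>2 \<partial>lebesgue) /
     (\<integral>x. (ball_torsion {()} (\<lambda>_. c) (\<lambda>_. r) x)\<^sup>2 \<partial>lebesgue)"

text \<open>The torsion function of the inner ball vanishes outside it, so its quotient over
  \<open>\<Omega>\<close> is the one over the whole space. This trial function also makes the set of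
  quotients nonempty, so that its real infimum is meaningful.\<close>

lemma lambda1_bounds:
  fixes c :: "'a::euclidean_space"
  assumes "ball c r \<subseteq> \<Omega>" "0 < r"
  shows "0 \<le> lambda1 \<Omega>" "lambda1 \<Omega> \<le> ball_rayleigh c r"
proof -
  let ?u = "ball_torsion {()} (\<lambda>_. c) (\<lambda>_. r)" and ?g = "ball_torsion_grad {()} (\<lambda>_. c) (\<lambda>_. r)"
  let ?S = "{(\<integral>x\<in>\<Omega>. (norm (g x))\<^sup>2 \<partial>lebesgue) / (\<integral>x\<in>\<Omega>. (u x)\<^sup>2 \<partial>lebesgue) | u g.
        H01 \<Omega> u g \<and> (\<integral>x\<in>\<Omega>. (u x)\<^sup>2 \<partial>lebesgue) \<noteq> 0}"
  have H: "H01 (ball c r) ?u ?g"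
    using H01_ball_torsion[of "{()}" "\<lambda>_. r" "\<lambda>_. c"] assms(2) by simp
  have zero: "?u x = 0" "?g x = 0" if "x \<notin> \<Omega>" for x
    using ball_torsion_eq_0[of "{()}" "\<lambda>_. r" x "\<lambda>_. c"] assms that by (auto simp: subset_eq)
  have eq: "(\<integral>x\<in>\<Omega>. (?u x)\<^sup>2 \<partial>lebesgue) = (\<integral>x. (?u x)\<^sup>2 \<partial>lebesgue)"
     "(\<integral>x\<in>\<Omega>. (norm (?g x))\<^sup>2 \<partial>lebesgue) = (\<integral>x. (norm (?g x))\<^sup>2 \<partial>lebesgue)"
    unfolding set_lebesgue_integral_def
    by (intro Bochner_Integration.integral_cong refl; use zero in \<open>auto simp: indicator_def\<close>)+
  have "0 < (\<integral>x. (?u x)\<^sup>2 \<partial>lebesgue)"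
  proof -
    \<comment> \<open>The value of the paraboloid on the sphere of radius \<open>r / 2\<close>,
      hence a positive lower bound for the trial function on the smaller ball; this keeps the
      denominator of the quotient positive.\<close>
    let ?k = "(r\<^sup>2 - (r / 2)\<^sup>2) / (2 * real DIM('a))"
    have k: "0 < ?k" using assms(2) by (simp add: power_divide)
    have "0 < ?k\<^sup>2 * measure lebesgue (ball c (r / 2))"
      using k assms(2) by (intro mult_pos_pos) auto
    also have "\<dots> = (\<integral>x. ?k\<^sup>2 * indicator (ball c (r / 2)) x \<partial>lebesgue)"
      by simp
    also have "\<dots> \<le> (\<integral>x. (?u x)\<^sup>2 \<partial>lebesgue)"
    proof (rule integral_mono')
      show "integrable lebesgue (\<lambda>x. (?u x)\<^sup>2)" using H by (simp add: H01_def)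
      fix x
      show "?k\<^sup>2 * indicator (ball c (r / 2)) x \<le> (?u x)\<^sup>2"
      proof (cases "x \<in> ball c (r / 2)")
        case True
        have "(norm (x - c))\<^sup>2 \<le> (r / 2)\<^sup>2"
          using True by (intro power_mono) (auto simp: dist_norm norm_minus_commute)
        then have "?k \<le> paraboloid c r x"
          by (simp add: paraboloid_def power2_norm_eq_inner divide_right_mono)
        then have "?k \<le> ?u x" by (simp add: ball_torsion_def)
        then show ?thesis using True k by (simp add: power_mono)
      qed simp
    qed simp
    finally show ?thesis .
  qed
  then have mem: "ball_rayleigh c r \<in> ?S"
    using H01_mono[OF H assms(1)] eq unfolding ball_rayleigh_def
    by (intro CollectI exI[of _ ?u] exI[of _ ?g]) auto
  have nonneg: "0 \<le> x" if "x \<in> ?S" for x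
    using that by (auto intro!: divide_nonneg_nonneg integral_nonneg_AE simp: set_lebesgue_integral_def)
  show "0 \<le> lambda1 \<Omega>"
    unfolding lambda1_def using mem nonneg by (intro cInf_greatest) auto
  show "lambda1 \<Omega> \<le> ball_rayleigh c r"
    unfolding lambda1_def using mem nonneg by (intro cInf_lower bdd_belowI[of _ 0]) auto
qed

section \<open>A family of domains with small \<open>Fp_of\<close>\<close>

text \<open>On each ball the torsion function is at most the square of the radius, so the integrand
  lies below a step function.\<close>

lemma integral_powr_ball_torsion_le:
  fixes c :: "'i \<Rightarrow> 'a::euclidean_space"
  assumes "finite I" and r: "\<And>i. i \<in> I \<Longrightarrow> 0 < r i"
    and disj: "disjoint_family_on (\<lambda>i. ball (c i) (r i)) I" and p: "0 \<le> p"
  shows "(\<integral>x\<in>(\<Union>i\<in>I. ball (c i) (r i)). \<bar>ball_torsion I c r x\<bar> powr p \<partial>lebesgue) \<le>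
    (\<Sum>i\<in>I. (r i)\<^sup>2 powr p * measure lebesgue (ball (c i) (r i)))"
proof -
  let ?\<Omega> = "\<Union>i\<in>I. ball (c i) (r i)"
  have fin: "integrable lebesgue (\<lambda>x. indicator (ball (c i) (r i)) x :: real)" for i
    by (intro integrable_real_indicator) (simp_all add: emeasure_lborel_ball_finite[simplified])
  have "(\<integral>x\<in>?\<Omega>. \<bar>ball_torsion I c r x\<bar> powr p \<partial>lebesgue) \<le>
    (\<integral>x. (\<Sum>i\<in>I. (r i)\<^sup>2 powr p * indicator (ball (c i) (r i)) x) \<partial>lebesgue)"
    unfolding set_lebesgue_integral_def
  proof (rule integral_mono')
    show "integrable lebesgue (\<lambda>x. \<Sum>i\<in>I. (r i)\<^sup>2 powr p * indicator (ball (c i) (r i)) x)"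
      by (intro Bochner_Integration.integrable_sum integrable_mult_right fin)
    fix x
    show nonneg: "0 \<le> (\<Sum>i\<in>I. (r i)\<^sup>2 powr p * indicator (ball (c i) (r i)) x)"
      by (intro sum_nonneg) auto
    show "indicator ?\<Omega> x *\<^sub>R \<bar>ball_torsion I c r x\<bar> powr p \<le>
      (\<Sum>i\<in>I. (r i)\<^sup>2 powr p * indicator (ball (c i) (r i)) x)"
    proof (cases "x \<in> ?\<Omega>")
      case True
      then obtain k where k: "k \<in> I" "x \<in> ball (c k) (r k)" by blast
      have "\<bar>ball_torsion I c r x\<bar> \<le> (r k)\<^sup>2"
        using ball_torsion_eq[OF assms(1) disj r k] ball_torsion_nonneg[of I c r x] paraboloid_le[of "c k" "r k" x]
        by simp
      then have "\<bar>ball_torsion I c r x\<bar> powr p \<le> (r k)\<^sup>2 powr p * indicator (ball (c k) (r k)) x"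
        using k p by (simp add: powr_mono2)
      also have "\<dots> \<le> (\<Sum>i\<in>I. (r i)\<^sup>2 powr p * indicator (ball (c i) (r i)) x)"
        using k assms(1) by (intro member_le_sum) auto
      finally show ?thesis using True by simp
    qed (use nonneg in simp)
  qed
  also have "\<dots> = (\<Sum>i\<in>I. (r i)\<^sup>2 powr p * measure lebesgue (ball (c i) (r i)))"
    by (subst Bochner_Integration.integral_sum) (auto intro!: integrable_mult_right fin)
  finally show ?thesis .
qed

lemma exists_small_Fp_of:
  fixes p :: real
  assumes p: "1 \<le> p"
  shows "\<exists>(\<Omega> :: 'a::euclidean_space set) v g. open \<Omega> \<and> 0 < measure lebesgue \<Omega> \<and>
    emeasure lebesgue \<Omega> < \<infinity> \<and> torsion \<Omega> v g \<and>
    Fp_of p \<Omega> v \<le> ball_rayleigh (0::'a) 1 * (2 / (1 + real (Suc n))) powr (1 / p)"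
proof -
  define j where "j = Suc n"
  \<comment> \<open>Balls of radius \<open>1 / j\<close> have volume \<open>j ^ DIM('a)\<close>
    times smaller than the unit ball; one further factor \<open>j\<close> makes their total volume
    grow like \<open>j\<close>.\<close>
  define N where "N = j ^ (DIM('a) + 1)"
  define e :: 'a where "e = (SOME b. b \<in> Basis)"
  have e: "norm e = 1" unfolding e_def by (simp add: SOME_Basis)
  \<comment> \<open>Centres on a ray at spacing 3, while two radii sum to at most 2. Index 0 is the
    unit ball at the origin, and the indices 1 to \<open>N\<close> are the small balls.\<close>
  define c where "c = (\<lambda>i. (3 * real i) *\<^sub>R e)"
  define r where "r = (\<lambda>i. if i = (0::nat) then 1 else 1 / real j)"
  let ?\<Omega> = "\<Union>i\<in>{..N}. ball (c i) (r i)"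
  let ?v = "ball_torsion {..N} c r" and ?g = "ball_torsion_grad {..N} c r"
  define \<omega> where "\<omega> = unit_ball_vol (real DIM('a))"
  have \<omega>: "0 < \<omega>" by (simp add: \<omega>_def unit_ball_vol_pos)
  have j: "1 \<le> real j" by (simp add: j_def)
  have r: "0 < r i" "r i \<le> 1" for i using j by (auto simp: r_def)
  have disj: "disjoint_family_on (\<lambda>i. ball (c i) (r i)) {..N}"
    unfolding disjoint_family_on_def
  proof (intro ballI impI)
    fix a b :: nat assume "a \<noteq> b"
    then have far: "1 \<le> \<bar>real a - real b\<bar>" by linarith
    have "c a - c b = (3 * (real a - real b)) *\<^sub>R e"
      by (simp add: c_def algebra_simps)
    then have "dist (c a) (c b) = 3 * \<bar>real a - real b\<bar>"
      using e by (simp add: dist_norm abs_if)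
    moreover have "r a + r b \<le> 3 * 1" using add_mono[OF r(2) r(2), of a b] by simp
    moreover have "3 * 1 \<le> 3 * \<bar>real a - real b\<bar>" using far by (intro mult_left_mono) auto
    ultimately have "r a + r b \<le> dist (c a) (c b)" by (simp only:)
    then show "ball (c a) (r a) \<inter> ball (c b) (r b) = {}" by (rule disjoint_ballI)
  qed
  have ball: "measure lebesgue (ball (c i) (r i)) = \<omega> * r i ^ DIM('a)" for i
    using r(1)[of i] by (simp add: content_ball \<omega>_def)
  have split: "(\<Sum>i\<le>N. f (r i)) = f 1 + real N * f (1 / real j)" for f :: "real \<Rightarrow> real"
    by (simp add: sum.atMost_shift r_def)
  have Nj: "real N * (1 / real j) ^ DIM('a) = real j"
    using j by (simp add: N_def power_divide)
  have fin: "ball (c i) (r i) \<in> fmeasurable lebesgue" for i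
    by (rule fmeasurableI) (simp_all add: emeasure_lborel_ball_finite[simplified])
  have vol: "measure lebesgue ?\<Omega> = \<omega> * (1 + real j)"
  proof -
    have "measure lebesgue ?\<Omega> = (\<Sum>i\<le>N. measure lebesgue (ball (c i) (r i)))"
      using fin by (intro measure_finite_Union disj)
        (auto simp: fmeasurable_def emeasure_lborel_ball_finite[simplified] less_top[symmetric])
    then show ?thesis using split[of "\<lambda>s. \<omega> * s ^ DIM('a)"] Nj by (simp add: ball algebra_simps)
  qed
  \<comment> \<open>The radius is at most 1 and \<open>p \<ge> 1\<close>, so the exponent
    \<open>p\<close> may be lowered to 1; the remaining \<open>j / j ^ 2\<close> is at most 1,
    uniformly in \<open>p\<close>.\<close>
  have "(1 / real j)\<^sup>2 powr p \<le> (1 / real j)\<^sup>2 powr 1"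
    using j p by (intro powr_mono') (auto simp: power_divide divide_le_eq)
  then have "(1 / real j)\<^sup>2 powr p \<le> (1 / real j)\<^sup>2" using j by simp
  then have "real j * ((1 / real j)\<^sup>2 powr p) \<le> real j * (1 / real j)\<^sup>2"
    using j by (intro mult_left_mono) auto
  also have "\<dots> \<le> 1" using j by (simp add: power2_eq_square)
  finally have jp: "real j * ((1 / real j)\<^sup>2 powr p) \<le> 1" .
  have "(\<integral>x\<in>?\<Omega>. \<bar>?v x\<bar> powr p \<partial>lebesgue) \<le> (\<Sum>i\<le>N. (r i)\<^sup>2 powr p * (\<omega> * r i ^ DIM('a)))"
    using integral_powr_ball_torsion_le[OF _ r(1) disj, of p] p by (simp add: ball)
  also have "\<dots> = \<omega> + real N * ((1 / real j)\<^sup>2 powr p * (\<omega> * (1 / real j) ^ DIM('a)))"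
    by (subst split[of "\<lambda>s. s\<^sup>2 powr p * (\<omega> * s ^ DIM('a))"]) simp
  also have "\<dots> = \<omega> + \<omega> * ((real N * (1 / real j) ^ DIM('a)) * (1 / real j)\<^sup>2 powr p)"
    by (simp only: mult_ac)
  also have "\<dots> \<le> \<omega> * 2"
    using mult_left_mono[OF jp, of \<omega>] \<omega> unfolding Nj by simp
  finally have int: "(\<integral>x\<in>?\<Omega>. \<bar>?v x\<bar> powr p \<partial>lebesgue) \<le> \<omega> * 2" .
  have int0: "0 \<le> (\<integral>x\<in>?\<Omega>. \<bar>?v x\<bar> powr p \<partial>lebesgue)"
    by (auto simp: set_lebesgue_integral_def intro!: integral_nonneg_AE)
  have sub: "ball 0 1 \<subseteq> ?\<Omega>"
  proof -
    have "ball (c 0) (r 0) \<subseteq> ?\<Omega>" by blast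
    then show ?thesis by (simp add: c_def r_def)
  qed
  note lam = lambda1_bounds[OF sub zero_less_one]
  \<comment> \<open>The unit ball and the small balls each contribute at most
    \<open>\<omega>\<close> to the integral, against a volume of \<open>\<omega> * (1 + j)\<close>;
    the factor \<open>\<omega>\<close> then cancels.\<close>
  have "Fp_of p ?\<Omega> ?v \<le> (\<omega> * 2) powr (1 / p) * ball_rayleigh (0::'a) 1 / (\<omega> * (1 + real j)) powr (1 / p)"
    unfolding Fp_of_def vol using int int0 lam p
    by (intro divide_right_mono mult_mono powr_mono2) auto
  also have "\<dots> = ball_rayleigh (0::'a) 1 * (2 / (1 + real j)) powr (1 / p)"
    using \<omega> j by (simp add: powr_divide powr_mult)
  finally have "Fp_of p ?\<Omega> ?v \<le> ball_rayleigh (0::'a) 1 * (2 / (1 + real j)) powr (1 / p)" .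
  moreover have "torsion ?\<Omega> ?v ?g" using torsion_ball_torsion[OF _ r(1) disj] by simp
  moreover have "emeasure lebesgue ?\<Omega> < \<infinity>"
    using emeasure_bounded_finite[of ?\<Omega>] by (simp add: bounded_UN)
  moreover have "0 < measure lebesgue ?\<Omega>" using vol \<omega> j by simp
  ultimately show ?thesis unfolding j_def[symmetric] by (intro exI[of _ ?\<Omega>] exI[of _ ?v] exI[of _ ?g]) auto
qed

text \<open>Positive measure makes the open set nonempty, so it contains a ball, and
  \<open>lambda1_bounds\<close> applies.\<close>

lemma Fp_of_nonneg:
  fixes \<Omega> :: "'a::euclidean_space set"
  assumes "open \<Omega>" "0 < measure lebesgue \<Omega>"
  shows "0 \<le> Fp_of p \<Omega> v"
proof -
  obtain x where "x \<in> \<Omega>" using assms(2) by fastforce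
  then obtain r where "0 < r" "ball x r \<subseteq> \<Omega>" using assms(1) open_contains_ball by blast
  then show ?thesis unfolding Fp_of_def
    by (intro divide_nonneg_nonneg mult_nonneg_nonneg lambda1_bounds(1)) auto
qed

theorem theorem2:
  fixes p :: real
  assumes "1 \<le> p"
  shows "Inf {Fp_of p \<Omega> v | (\<Omega> :: 'a::euclidean_space set) v g.
            open \<Omega> \<and> 0 < measure lebesgue \<Omega> \<and> emeasure lebesgue \<Omega> < \<infinity> \<and> torsion \<Omega> v g} = 0"
    (is "Inf ?S = 0")
proof (rule antisym)
  have small: "\<exists>y\<in>?S. y \<le> ball_rayleigh (0::'a) 1 * (2 / (1 + real (Suc n))) powr (1 / p)" for n
    using exists_small_Fp_of[OF assms, of n] by blast
  have nonneg: "0 \<le> y" if "y \<in> ?S" for y using that Fp_of_nonneg by blast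
  \<comment> \<open>The instance \<open>n = 0\<close> of the family shows that the set is
    nonempty.\<close>
  show "0 \<le> Inf ?S" using small[of 0] nonneg by (intro cInf_greatest) auto
  have "(\<lambda>n. (2 / (1 + real (Suc n))) powr (1 / p)) \<longlonglongrightarrow> 0"
  proof (rule tendsto_zero_powrI)
    have "(\<lambda>n. 2 * inverse (real (Suc (Suc n)))) \<longlonglongrightarrow> 2 * 0"
      by (intro tendsto_mult tendsto_const LIMSEQ_Suc[OF LIMSEQ_inverse_real_of_nat])
    then show "(\<lambda>n. 2 / (1 + real (Suc n))) \<longlonglongrightarrow> 0" by (simp add: field_simps)
  qed (use assms in auto)
  from tendsto_mult[OF tendsto_const this, of "ball_rayleigh (0::'a) 1"]
  have "(\<lambda>n. ball_rayleigh (0::'a) 1 * (2 / (1 + real (Suc n))) powr (1 / p)) \<longlonglongrightarrow> 0" by simp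
  then show "Inf ?S \<le> 0"
  proof (rule LIMSEQ_le_const)
    \<comment> \<open>Nonnegativity bounds the set below, so the infimum is at most each member, in
      particular those of the family.\<close>
    have "Inf ?S \<le> ball_rayleigh (0::'a) 1 * (2 / (1 + real (Suc n))) powr (1 / p)" for n
      using small[of n] nonneg by (meson bdd_belowI cInf_lower order_trans)
    then show "\<exists>N. \<forall>n\<ge>N. Inf ?S \<le> ball_rayleigh (0::'a) 1 * (2 / (1 + real (Suc n))) powr (1 / p)"
      by blast
  qed
qed

end
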